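(* For every integer $n\ge 6$ there exists a rational pointed $n$-dimensional cone $C_n\subseteq\mathbb{R}^n$ such that \[ \operatorname{CR^{\rm a}}(C_n)\ge\left\lfloor\tfrac{7}{6}n\right\rfloor . \]
   Context: A cone $C\subseteq\mathbb{R}^n$ is rational if $C=\{\bm{x}\in\mathbb{R}^n:\bm{A}\bm{x}\ge\bm{0}\}$ for some integer matrix $\bm{A}$; it is pointed if $C\cap(-C)=\{\bm{0}\}$; its dimension is the maximal number of linearly independent vectors in $C$. The integer points $S=C\cap\mathbb{Z}^n$ form a semigroup which has a unique inclusion-minimal finite generating set $H(C)$ (every element of $S$ is a non-negative integer combination of elements of $H(C)$), called the Hilbert basis of $C$. For $\bm{x}\in S$, $\sigma(\bm{x})=\min\{l:\bm{x}=\lambda_1\bm{h}_1+\cdots+\lambda_l\bm{h}_l,\ \lambda_i\in\mathbb{Z}_{\ge0},\ \bm{h}_i\in H(C)\}$. The asymptotic integer Carathéodory rank $\operatorname{CR^{\rm a}}(C)$ is the smallest positive integer $k$ such that \[ \lim_{\delta\to\infty}\frac{|\{\bm{x}\in S:\sigma(\bm{x})\le k\}\cap[-\delta,\delta]^n|}{|S\cap[-\delta,\delta]^n|}=1 . \] *)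

theory Defs
  imports "HOL-Analysis.Analysis"
begin

text \<open>
  Euclidean $n$-space is \<^typ>\<open>real ^ 'n\<close> with $n$ = \<open>CARD('n)\<close>. The number of rows of the
  constraint matrix is independent of \<open>'n\<close>, so the matrix is given by its entries
  \<open>A i j\<close> with row index \<open>i < m\<close> and column index \<open>j :: 'n\<close>.
\<close>

definition rational_cone :: "(real ^ 'n::finite) set \<Rightarrow> bool" where
  "rational_cone C \<longleftrightarrow>
     (\<exists>(m::nat) (A :: nat \<Rightarrow> 'n \<Rightarrow> int).
        C = {x. \<forall>i<m. (\<Sum>j\<in>UNIV. of_int (A i j) * x $ j) \<ge> 0})"

definition pointed :: "(real ^ 'n::finite) set \<Rightarrow> bool" where
  "pointed C \<longleftrightarrow> C \<inter> uminus ` C = {0}"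

definition int_points :: "(real ^ 'n::finite) set \<Rightarrow> (real ^ 'n) set" where
  "int_points C = {x \<in> C. \<forall>i. x $ i \<in> \<int>}"

definition generates :: "(real ^ 'n::finite) set \<Rightarrow> (real ^ 'n) set \<Rightarrow> bool" where
  "generates H S \<longleftrightarrow> finite H \<and> H \<subseteq> S \<and>
     (\<forall>x\<in>S. \<exists>c :: real ^ 'n \<Rightarrow> nat. x = (\<Sum>h\<in>H. real (c h) *\<^sub>R h))"

text \<open>
  For a pointed rational cone, exactly one set satisfies the description below. For
  non-pointed cones uniqueness may fail, and the value is then unspecified.
\<close>

definition hilbert_basis :: "(real ^ 'n::finite) set \<Rightarrow> (real ^ 'n) set" where
  "hilbert_basis C =
     (THE H. generates H (int_points C) \<and> (\<forall>H'. H' \<subset> H \<longrightarrow> \<not> generates H' (int_points C)))"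

definition hilbert_length :: "(real ^ 'n::finite) set \<Rightarrow> real ^ 'n \<Rightarrow> nat" where
  "hilbert_length C x =
     (LEAST l. \<exists>(h :: nat \<Rightarrow> real ^ 'n) (c :: nat \<Rightarrow> nat).
        (\<forall>i\<in>{1..l}. h i \<in> hilbert_basis C) \<and> x = (\<Sum>i=1..l. real (c i) *\<^sub>R h i))"

definition box_points :: "(real ^ 'n::finite) set \<Rightarrow> real \<Rightarrow> (real ^ 'n) set" where
  "box_points X \<delta> = X \<inter> cbox (\<chi> i. - \<delta>) (\<chi> i. \<delta>)"

text \<open>
  The \<open>LEAST\<close> is over a non-empty set for a pointed rational cone: the function
  \<^const>\<open>hilbert_length\<close> is bounded on the integer points by the size of the Hilbert basis.
\<close>

definition asymptotic_caratheodory_rank :: "(real ^ 'n::finite) set \<Rightarrow> nat" where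
  "asymptotic_caratheodory_rank C =
     (LEAST k. k > 0 \<and>
        ((\<lambda>\<delta>. real (card (box_points {x \<in> int_points C. hilbert_length C x \<le> k} \<delta>))
               / real (card (box_points (int_points C) \<delta>))) \<longlongrightarrow> 1) at_top)"

end

theory Submission
  imports Defs
begin

text \<open>
  Up to a unimodular change of coordinates, the 6-dimensional cone of Bruns, Gubeladze, Henk, Martin
  and Weismantel has coordinates \<open>(m, c\<^sub>0, \<dots>, c\<^sub>4)\<close> and ten generators: the unit vectors in the
  \<open>c\<close>-directions, and for each vertex \<open>k\<close> of a pentagon the vector with \<open>m = 1\<close>, \<open>c\<^sub>k = -1\<close> and \<open>c = 1\<close> at
  the two neighbours of \<open>k\<close>. A point \<open>(m, c)\<close> therefore is a combination of the generators iff there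
  is \<open>u \<ge> 0\<close> on the pentagon with sum \<open>m\<close> and \<open>u\<^sub>k\<^sub>-\<^sub>1 + u\<^sub>k\<^sub>+\<^sub>1 - u\<^sub>k \<le> c\<^sub>k\<close>, and the generators form the Hilbert
  basis because a real solution \<open>u\<close> can be rounded to an integral one when \<open>m\<close> and \<open>c\<close> are integral.
  Near the ray through \<open>(5, 2, 2, 2, 2, 2)\<close> a combination of six generators has to use three consecutive
  \<open>u\<close>-generators and three unit vectors of a fixed pattern; these sublattices have index 2 or 3, and
  the points with \<open>m \<equiv> 1\<close> and \<open>c \<equiv> 0\<close> modulo 6 lie in none of them. These points have positive
  density and need seven generators.

  For \<open>n = 6 q + r\<close> with \<open>r < 6\<close> the product of \<open>q\<close> copies of this cone with an orthant of dimension \<open>r\<close>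
  has rank at least \<open>7 q + r\<close>, which is the floor of \<open>7 n / 6\<close>.
\<close>

subsection \<open>The six-dimensional cone\<close>

text \<open>Coordinate 0 is \<open>m\<close> and coordinate \<open>k + 1\<close> is \<open>c\<^sub>k\<close>; the unit vectors come first.\<close>

definition block_gen :: "nat \<Rightarrow> nat \<Rightarrow> int" where
  "block_gen i s =
     (if i < 5 then of_bool (s = i + 1)
      else if s = 0 then 1
      else if s = i - 4 then -1
      else of_bool (s = (i - 4) mod 5 + 1 \<or> s = (i - 1) mod 5 + 1))"

lemma lessThan_10: "{..<10::nat} = {0,1,2,3,4,5,6,7,8,9}"
  by auto

text \<open>Multipliers 5 to 9 are the values \<open>u\<close> at the pentagon vertices; multipliers
  0 to 4 are the slacks of the vertex inequalities. The general ring covers real and integer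
  multipliers alike.\<close>

lemma block_gen_sum:
  fixes f :: "nat \<Rightarrow> 'a::comm_ring_1"
  shows "(\<Sum>i<10. f i * of_int (block_gen i 0)) = f 5 + f 6 + f 7 + f 8 + f 9"
    and "(\<Sum>i<10. f i * of_int (block_gen i 1)) = f 0 + f 6 + f 9 - f 5"
    and "(\<Sum>i<10. f i * of_int (block_gen i 2)) = f 1 + f 7 + f 5 - f 6"
    and "(\<Sum>i<10. f i * of_int (block_gen i 3)) = f 2 + f 8 + f 6 - f 7"
    and "(\<Sum>i<10. f i * of_int (block_gen i 4)) = f 3 + f 9 + f 7 - f 8"
    and "(\<Sum>i<10. f i * of_int (block_gen i 5)) = f 4 + f 5 + f 8 - f 9"
  by (simp_all add: lessThan_10 block_gen_def)

lemma less_6_iff: "(s::nat) < 6 \<longleftrightarrow> s = 0 \<or> s = 1 \<or> s = 2 \<or> s = 3 \<or> s = 4 \<or> s = 5"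
  by auto

section \<open>Rounding multipliers on the pentagon\<close>

text \<open>With every \<open>u\<close> in [0, 1) only finitely many cases remain: each c exceeds
  -1, so it is nonnegative, and \<open>m\<close> is between 0 and 4. For each \<open>m\<close> the
  real inequalities force enough of the c to be positive for an explicit \<open>v\<close> with
  entries 0, 1, 2 to fit.\<close>

lemma pentagon_rounding_fractional:
  fixes u0 u1 u2 u3 u4 :: real and m c0 c1 c2 c3 c4 :: int
  assumes u: "0 \<le> u0" "0 \<le> u1" "0 \<le> u2" "0 \<le> u3" "0 \<le> u4"
    "u0 < 1" "u1 < 1" "u2 < 1" "u3 < 1" "u4 < 1"
    and m: "u0 + u1 + u2 + u3 + u4 = of_int m"
    and c: "u1 + u4 - u0 \<le> of_int c0" "u2 + u0 - u1 \<le> of_int c1" "u3 + u1 - u2 \<le> of_int c2"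
      "u4 + u2 - u3 \<le> of_int c3" "u0 + u3 - u4 \<le> of_int c4"
  obtains v0 v1 v2 v3 v4 :: int
  where "0 \<le> v0" "0 \<le> v1" "0 \<le> v2" "0 \<le> v3" "0 \<le> v4"
    "v0 + v1 + v2 + v3 + v4 = m"
    "v1 + v4 - v0 \<le> c0" "v2 + v0 - v1 \<le> c1" "v3 + v1 - v2 \<le> c2"
    "v4 + v2 - v3 \<le> c3" "v0 + v3 - v4 \<le> c4"
proof -
  have nonneg: "0 \<le> c0" "0 \<le> c1" "0 \<le> c2" "0 \<le> c3" "0 \<le> c4" using u c by linarith+
  have "0 \<le> m" "m < 5" using u m by linarith+
  then consider "m = 0" | "m = 1 \<or> m = 2" | "m = 3" | "m = 4" by linarith
  then show thesis
  proof cases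
    case 1
    then show thesis using that[of 0 0 0 0 0] nonneg by simp
  next
    case two: 2
    then have sum: "1 \<le> u0 + u1 + u2 + u3 + u4" using m by linarith
    have zero: "of_int c \<le> (0::real)" if "\<not> 1 \<le> c" for c :: int using that by simp
    \<comment> \<open>Without a non-adjacent pair, the vertices with positive c would lie on one
      edge. The inequalities at the three other, consecutive vertices then force every
      \<open>u\<close> to be 0, against \<open>sum\<close>.\<close>
    have "(1 \<le> c0 \<and> 1 \<le> c2) \<or> (1 \<le> c1 \<and> 1 \<le> c3) \<or> (1 \<le> c2 \<and> 1 \<le> c4)
      \<or> (1 \<le> c3 \<and> 1 \<le> c0) \<or> (1 \<le> c4 \<and> 1 \<le> c1)" (is ?two)
    proof (rule ccontr)
      assume "\<not> ?two"
      then consider "\<not> 1 \<le> c0" "\<not> 1 \<le> c1" "\<not> 1 \<le> c2" | "\<not> 1 \<le> c1" "\<not> 1 \<le> c2" "\<not> 1 \<le> c3"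
        | "\<not> 1 \<le> c2" "\<not> 1 \<le> c3" "\<not> 1 \<le> c4" | "\<not> 1 \<le> c3" "\<not> 1 \<le> c4" "\<not> 1 \<le> c0"
        | "\<not> 1 \<le> c4" "\<not> 1 \<le> c0" "\<not> 1 \<le> c1"
        by blast
      then show False
      proof cases
        case 1 show False using 1[THEN zero] c(1,2,3) u(1-5) sum by linarith
      next
        case 2 show False using 2[THEN zero] c(2,3,4) u(1-5) sum by linarith
      next
        case 3 show False using 3[THEN zero] c(3,4,5) u(1-5) sum by linarith
      next
        case 4 show False using 4[THEN zero] c(4,5,1) u(1-5) sum by linarith
      next
        case 5 show False using 5[THEN zero] c(5,1,2) u(1-5) sum by linarith
      qed
    qed
    then consider "1 \<le> c0" "1 \<le> c2" | "1 \<le> c1" "1 \<le> c3" | "1 \<le> c2" "1 \<le> c4" | "1 \<le> c3" "1 \<le> c0" | "1 \<le> c4" "1 \<le> c1"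
      by blast
    then show thesis
    proof cases
      \<comment> \<open>Given positive c at a non-adjacent pair, \<open>m = 1\<close> is placed at
        their common neighbour and \<open>m = 2\<close> on the two vertices of the opposite
        edge.\<close>
      case 1
      show thesis
      proof (rule disjE[OF two])
        assume "m = 1"
        then show thesis by (intro that[of 0 1 0 0 0]) (use 1 nonneg in linarith)+
      next
        assume "m = 2"
        then show thesis by (intro that[of 0 0 0 1 1]) (use 1 nonneg in linarith)+
      qed
    next
      case 2
      show thesis
      proof (rule disjE[OF two])
        assume "m = 1"
        then show thesis by (intro that[of 0 0 1 0 0]) (use 2 nonneg in linarith)+
      next
        assume "m = 2"
        then show thesis by (intro that[of 1 0 0 0 1]) (use 2 nonneg in linarith)+
      qed
    next
      case 3
      show thesis
      proof (rule disjE[OF two])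
        assume "m = 1"
        then show thesis by (intro that[of 0 0 0 1 0]) (use 3 nonneg in linarith)+
      next
        assume "m = 2"
        then show thesis by (intro that[of 1 1 0 0 0]) (use 3 nonneg in linarith)+
      qed
    next
      case 4
      show thesis
      proof (rule disjE[OF two])
        assume "m = 1"
        then show thesis by (intro that[of 0 0 0 0 1]) (use 4 nonneg in linarith)+
      next
        assume "m = 2"
        then show thesis by (intro that[of 0 1 1 0 0]) (use 4 nonneg in linarith)+
      qed
    next
      case 5
      show thesis
      proof (rule disjE[OF two])
        assume "m = 1"
        then show thesis by (intro that[of 1 0 0 0 0]) (use 5 nonneg in linarith)+
      next
        assume "m = 2"
        then show thesis by (intro that[of 0 0 1 1 0]) (use 5 nonneg in linarith)+
      qed
    qed
  next
    case three: 3
    then have sum: "u0 + u1 + u2 + u3 + u4 = 3" using m by linarith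
    have pair: "of_int c \<le> (0::real) \<and> of_int d \<le> (0::real)" if "\<not> (1 \<le> c \<or> 1 \<le> d)" for c d :: int
      using that by simp
    \<comment> \<open>If both c of an edge are at most 0, adding their inequalities makes
      \<open>u\<close> vanish at the two outer neighbours, and three values below 1 cannot sum to 3.
      So the vertices with positive c cover all edges. The cases below are the minimal covers; the
      witness is the isolated vertex of the cover together with its two neighbours.\<close>
    have "1 \<le> c0 \<or> 1 \<le> c1"
      by (rule ccontr, drule pair) (use c(1,2) u sum in linarith)
    moreover have "1 \<le> c1 \<or> 1 \<le> c2"
      by (rule ccontr, drule pair) (use c(2,3) u sum in linarith)
    moreover have "1 \<le> c2 \<or> 1 \<le> c3"
      by (rule ccontr, drule pair) (use c(3,4) u sum in linarith)
    moreover have "1 \<le> c3 \<or> 1 \<le> c4"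
      by (rule ccontr, drule pair) (use c(4,5) u sum in linarith)
    moreover have "1 \<le> c4 \<or> 1 \<le> c0"
      by (rule ccontr, drule pair) (use c(5,1) u sum in linarith)
    ultimately consider "1 \<le> c0" "1 \<le> c2" "1 \<le> c3" | "1 \<le> c1" "1 \<le> c3" "1 \<le> c4" | "1 \<le> c2" "1 \<le> c4" "1 \<le> c0" | "1 \<le> c3" "1 \<le> c0" "1 \<le> c1" | "1 \<le> c4" "1 \<le> c1" "1 \<le> c2"
      by blast
    then show thesis
    proof cases
      case 1
      then show thesis by (intro that[of 1 1 0 0 1]) (use three nonneg in linarith)+
    next
      case 2
      then show thesis by (intro that[of 1 1 1 0 0]) (use three nonneg in linarith)+
    next
      case 3
      then show thesis by (intro that[of 0 1 1 1 0]) (use three nonneg in linarith)+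
    next
      case 4
      then show thesis by (intro that[of 0 0 1 1 1]) (use three nonneg in linarith)+
    next
      case 5
      then show thesis by (intro that[of 1 0 0 1 1]) (use three nonneg in linarith)+
    qed
  next
    case 4
    \<comment> \<open>Each left-hand side is 4 minus a sum of four terms below 1, hence
      positive.\<close>
    have "1 \<le> c0" "1 \<le> c1" "1 \<le> c2" "1 \<le> c3" "1 \<le> c4" using u c m 4 by linarith+
    then show thesis using that[of 2 1 0 0 1] 4 by simp
  qed
qed

text \<open>Only the fractional parts of the pentagon multipliers are rounded, their integer parts
  being kept. The multipliers of the unit vectors are then recomputed as slacks, which the rounded
  inequalities make nonnegative.\<close>

lemma block_rounding:
  fixes l :: "nat \<Rightarrow> real"
  assumes nonneg: "\<And>i. i < 10 \<Longrightarrow> 0 \<le> l i"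
    and int: "\<And>s. s < 6 \<Longrightarrow> (\<Sum>i<10. l i * of_int (block_gen i s)) \<in> \<int>"
  shows "\<exists>\<mu>::nat \<Rightarrow> nat. \<forall>s<6. (\<Sum>i<10. real (\<mu> i) * of_int (block_gen i s)) = (\<Sum>i<10. l i * of_int (block_gen i s))"
proof -
  define y where "y s = \<lfloor>\<Sum>i<10. l i * of_int (block_gen i s)\<rfloor>" for s
  have y: "(\<Sum>i<10. l i * of_int (block_gen i s)) = of_int (y s)" if "s < 6" for s
    using int[OF that] by (simp add: y_def of_int_floor_cancel)
  have eqs: "l 5 + l 6 + l 7 + l 8 + l 9 = y 0" "l 0 + l 6 + l 9 - l 5 = y 1" "l 1 + l 7 + l 5 - l 6 = y 2"
    "l 2 + l 8 + l 6 - l 7 = y 3" "l 3 + l 9 + l 7 - l 8 = y 4" "l 4 + l 5 + l 8 - l 9 = y 5"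
    using y[of 0] y[of 1] y[of 2] y[of 3] y[of 4] y[of 5] unfolding block_gen_sum by simp_all
  have pos: "0 \<le> l 0" "0 \<le> l 1" "0 \<le> l 2" "0 \<le> l 3" "0 \<le> l 4" "0 \<le> l 5" "0 \<le> l 6" "0 \<le> l 7" "0 \<le> l 8" "0 \<le> l 9"
    using nonneg by auto
  define w where "w i = \<lfloor>l i\<rfloor>" for i
  have w: "0 \<le> l i - w i" "l i - w i < 1" for i unfolding w_def by linarith+
  have w0: "0 \<le> w 5" "0 \<le> w 6" "0 \<le> w 7" "0 \<le> w 8" "0 \<le> w 9" using pos by (simp_all add: w_def)
  define u where "u i = l i - w i" for i
  have "u 5 + u 6 + u 7 + u 8 + u 9 = of_int (y 0 - (w 5 + w 6 + w 7 + w 8 + w 9))"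
    "u 6 + u 9 - u 5 \<le> of_int (y 1 - (w 6 + w 9 - w 5))"
    "u 7 + u 5 - u 6 \<le> of_int (y 2 - (w 7 + w 5 - w 6))"
    "u 8 + u 6 - u 7 \<le> of_int (y 3 - (w 8 + w 6 - w 7))"
    "u 9 + u 7 - u 8 \<le> of_int (y 4 - (w 9 + w 7 - w 8))"
    "u 5 + u 8 - u 9 \<le> of_int (y 5 - (w 5 + w 8 - w 9))"
    unfolding of_int_diff of_int_add u_def using eqs pos by linarith+
  note sums = this
  obtain v5 v6 v7 v8 v9 :: int where v: "0 \<le> v5" "0 \<le> v6" "0 \<le> v7" "0 \<le> v8" "0 \<le> v9"
    "v5 + v6 + v7 + v8 + v9 = y 0 - (w 5 + w 6 + w 7 + w 8 + w 9)"
    "v6 + v9 - v5 \<le> y 1 - (w 6 + w 9 - w 5)"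
    "v7 + v5 - v6 \<le> y 2 - (w 7 + w 5 - w 6)"
    "v8 + v6 - v7 \<le> y 3 - (w 8 + w 6 - w 7)"
    "v9 + v7 - v8 \<le> y 4 - (w 9 + w 7 - w 8)"
    "v5 + v8 - v9 \<le> y 5 - (w 5 + w 8 - w 9)"
    using pentagon_rounding_fractional[OF w(1)[of 5] w(1)[of 6] w(1)[of 7] w(1)[of 8] w(1)[of 9]
          w(2)[of 5] w(2)[of 6] w(2)[of 7] w(2)[of 8] w(2)[of 9], folded u_def, OF sums]
    by blast
  define \<nu> where "\<nu> = (\<lambda>i. [y 1 - (w 6 + w 9 - w 5) - (v6 + v9 - v5),
      y 2 - (w 7 + w 5 - w 6) - (v7 + v5 - v6),
      y 3 - (w 8 + w 6 - w 7) - (v8 + v6 - v7),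
      y 4 - (w 9 + w 7 - w 8) - (v9 + v7 - v8),
      y 5 - (w 5 + w 8 - w 9) - (v5 + v8 - v9),
      w 5 + v5, w 6 + v6, w 7 + v7, w 8 + v8, w 9 + v9] ! i)"
  have \<nu>0: "0 \<le> \<nu> i" if "i < 10" for i
  proof -
    have "i \<in> {0,1,2,3,4,5,6,7,8,9}" using that lessThan_10 by blast
    then show ?thesis using v w0 by (auto simp: \<nu>_def)
  qed
  have "(\<Sum>i<10. real (nat (\<nu> i)) * of_int (block_gen i s)) = (\<Sum>i<10. l i * of_int (block_gen i s))" if "s < 6" for s
  proof -
    have "(\<Sum>i<10. real (nat (\<nu> i)) * of_int (block_gen i s)) = of_int (\<Sum>i<10. \<nu> i * of_int (block_gen i s))"
      by (simp add: \<nu>0)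
    also have "(\<Sum>i<10. \<nu> i * of_int (block_gen i s)) = y s"
      using that[unfolded less_6_iff] v(6)
      by (elim disjE) (simp_all only: block_gen_sum, simp_all add: \<nu>_def)
    finally show ?thesis using y[OF that] by simp
  qed
  then show ?thesis by (intro exI[of _ "\<lambda>i. nat (\<nu> i)"]) auto
qed

section \<open>Support size from congruences modulo 6\<close>

text \<open>Here \<open>x\<close>, \<open>y\<close>, \<open>z\<close> stand for the multipliers at
  three consecutive vertices when the other two vanish; each alternative comes from one pair of
  missing unit vectors. In the third all three are congruent, so \<open>3 * y\<close> would be 1
  modulo 6. In the others one end is divisible by 6 and the remaining two agree, so an even number
  would be 1 modulo 6.\<close>

lemma odd_triple:
  fixes x y z P :: int
  assumes "x + y + z = 6 * P + 1"
    and "(6 dvd z \<and> 6 dvd y - x) \<or> (6 dvd x \<and> 6 dvd z + x - y) \<or> (6 dvd y - x \<and> 6 dvd y - z)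
      \<or> (6 dvd z + x - y \<and> 6 dvd z) \<or> (6 dvd y - z \<and> 6 dvd x)"
  shows False
  using assms(2)
proof (elim disjE conjE)
  assume "6 dvd z" "6 dvd y - x"
  then show False using assms(1) by presburger
next
  assume "6 dvd x" "6 dvd z + x - y"
  then show False using assms(1) by presburger
next
  assume "6 dvd y - x" "6 dvd y - z"
  then show False using assms(1) by presburger
next
  assume "6 dvd z + x - y" "6 dvd z"
  then show False using assms(1) by presburger
next
  assume "6 dvd y - z" "6 dvd x"
  then show False using assms(1) by presburger
qed

text \<open>The size conditions allow at most two missing pentagon generators, necessarily at
  adjacent vertices, and at most two missing unit vectors, necessarily at non-adjacent ones. A
  support of size six would miss two of each kind, which \<open>odd_triple\<close> excludes.\<close>

lemma block_support:
  fixes \<mu> :: "nat \<Rightarrow> nat" and P :: int and Q :: "nat \<Rightarrow> int"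
  assumes L: "1 \<le> L"
    and P: "15 * L \<le> P" "P \<le> 16 * L"
    and Q: "\<And>s. s \<in> {1..5} \<Longrightarrow> 6 * L \<le> Q s \<and> Q s \<le> 7 * L"
    and m: "(\<Sum>i<10. int (\<mu> i) * block_gen i 0) = 6 * P + 1"
    and c: "\<And>s. s \<in> {1..5} \<Longrightarrow> (\<Sum>i<10. int (\<mu> i) * block_gen i s) = 6 * Q s"
  shows "7 \<le> card {i\<in>{..<10}. \<mu> i \<noteq> 0}"
proof -
  define f where "f i = int (\<mu> i)" for i
  have pos: "0 \<le> f i" for i by (simp add: f_def)
  have eqs: "f 5 + f 6 + f 7 + f 8 + f 9 = 6 * P + 1" "f 0 + f 6 + f 9 - f 5 = 6 * Q 1"
    "f 1 + f 7 + f 5 - f 6 = 6 * Q 2" "f 2 + f 8 + f 6 - f 7 = 6 * Q 3"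
    "f 3 + f 9 + f 7 - f 8 = 6 * Q 4" "f 4 + f 5 + f 8 - f 9 = 6 * Q 5"
    using m c[of 1] c[of 2] c[of 3] c[of 4] c[of 5] block_gen_sum[of f] by (simp_all add: f_def)
  have total: "f 5 + f 6 + f 7 + f 8 + f 9 > 90 * L" using eqs(1) P by linarith
  \<comment> \<open>If both neighbours of a vertex carry 0, the equations at these neighbours bound
    the total by \<open>84 * L\<close>, but it exceeds \<open>90 * L\<close>.\<close>
  have u: "f 9 \<noteq> 0 \<or> f 6 \<noteq> 0" "f 5 \<noteq> 0 \<or> f 7 \<noteq> 0" "f 6 \<noteq> 0 \<or> f 8 \<noteq> 0" "f 7 \<noteq> 0 \<or> f 9 \<noteq> 0" "f 8 \<noteq> 0 \<or> f 5 \<noteq> 0"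
    subgoal by (rule ccontr) (use total eqs(6,3) Q[of 5] Q[of 2] pos[of 4] pos[of 1] pos[of 5] L in simp)
    subgoal by (rule ccontr) (use total eqs(2,4) Q[of 1] Q[of 3] pos[of 0] pos[of 2] pos[of 6] L in simp)
    subgoal by (rule ccontr) (use total eqs(3,5) Q[of 2] Q[of 4] pos[of 1] pos[of 3] pos[of 7] L in simp)
    subgoal by (rule ccontr) (use total eqs(4,6) Q[of 3] Q[of 5] pos[of 2] pos[of 4] pos[of 8] L in simp)
    subgoal by (rule ccontr) (use total eqs(5,2) Q[of 4] Q[of 1] pos[of 3] pos[of 0] pos[of 9] L in simp)
    done
  \<comment> \<open>If \<open>f 0\<close> and \<open>f 1\<close> vanish, the equations at vertices 0
    and 1 add up to \<open>f 7 + f 9 \<ge> 72 * L\<close>, and the one at vertex 3 gives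
    \<open>f 8 \<ge> 30 * L\<close>. The total would be at least \<open>102 * L\<close>, above its
    maximum \<open>96 * L + 1\<close>. The other edges follow by rotation.\<close>
  have a: "f 0 \<noteq> 0 \<or> f 1 \<noteq> 0" "f 1 \<noteq> 0 \<or> f 2 \<noteq> 0" "f 2 \<noteq> 0 \<or> f 3 \<noteq> 0" "f 3 \<noteq> 0 \<or> f 4 \<noteq> 0" "f 4 \<noteq> 0 \<or> f 0 \<noteq> 0"
    subgoal by (rule ccontr) (use eqs(1,2,3,5) Q[of 1] Q[of 2] Q[of 4] P pos[of 3] pos[of 5] pos[of 6] L in simp)
    subgoal by (rule ccontr) (use eqs(1,3,4,6) Q[of 2] Q[of 3] Q[of 5] P pos[of 4] pos[of 6] pos[of 7] L in simp)
    subgoal by (rule ccontr) (use eqs(1,4,5,2) Q[of 3] Q[of 4] Q[of 1] P pos[of 0] pos[of 7] pos[of 8] L in simp)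
    subgoal by (rule ccontr) (use eqs(1,5,6,3) Q[of 4] Q[of 5] Q[of 2] P pos[of 1] pos[of 8] pos[of 9] L in simp)
    subgoal by (rule ccontr) (use eqs(1,6,2,4) Q[of 5] Q[of 1] Q[of 3] P pos[of 2] pos[of 9] pos[of 5] L in simp)
    done
  have d: "f 0 = 0 \<Longrightarrow> 6 dvd f 6 + f 9 - f 5" "f 1 = 0 \<Longrightarrow> 6 dvd f 7 + f 5 - f 6"
    "f 2 = 0 \<Longrightarrow> 6 dvd f 8 + f 6 - f 7" "f 3 = 0 \<Longrightarrow> 6 dvd f 9 + f 7 - f 8"
    "f 4 = 0 \<Longrightarrow> 6 dvd f 5 + f 8 - f 9"
    using eqs(2-6) by simp_all
  have parity: False
    if zu: "(f 5 = 0 \<and> f 6 = 0) \<or> (f 6 = 0 \<and> f 7 = 0) \<or> (f 7 = 0 \<and> f 8 = 0) \<or> (f 8 = 0 \<and> f 9 = 0) \<or> (f 9 = 0 \<and> f 5 = 0)"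
      and za: "(f 0 = 0 \<and> f 2 = 0) \<or> (f 1 = 0 \<and> f 3 = 0) \<or> (f 2 = 0 \<and> f 4 = 0) \<or> (f 3 = 0 \<and> f 0 = 0) \<or> (f 4 = 0 \<and> f 1 = 0)"
    using zu
  proof (elim disjE conjE)
    assume "f 5 = 0" "f 6 = 0"
    then show False using odd_triple[of "f 7" "f 8" "f 9" P] za d eqs(1) by (auto simp: algebra_simps)
  next
    assume "f 6 = 0" "f 7 = 0"
    then show False using odd_triple[of "f 8" "f 9" "f 5" P] za d eqs(1) by (auto simp: algebra_simps)
  next
    assume "f 7 = 0" "f 8 = 0"
    then show False using odd_triple[of "f 9" "f 5" "f 6" P] za d eqs(1) by (auto simp: algebra_simps)
  next
    assume "f 8 = 0" "f 9 = 0"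
    then show False using odd_triple[of "f 5" "f 6" "f 7" P] za d eqs(1) by (auto simp: algebra_simps)
  next
    assume "f 9 = 0" "f 5 = 0"
    then show False using odd_triple[of "f 6" "f 7" "f 8" P] za d eqs(1) by (auto simp: algebra_simps)
  qed
  define z where "z i = (if f i = 0 then 0 else 1 :: nat)" for i
  have zu: "3 \<le> z 5 + z 6 + z 7 + z 8 + z 9"
    "z 5 + z 6 + z 7 + z 8 + z 9 = 3 \<Longrightarrow> (f 5 = 0 \<and> f 6 = 0) \<or> (f 6 = 0 \<and> f 7 = 0) \<or> (f 7 = 0 \<and> f 8 = 0) \<or> (f 8 = 0 \<and> f 9 = 0) \<or> (f 9 = 0 \<and> f 5 = 0)"
    using u by (auto simp: z_def split: if_splits)
  have za: "3 \<le> z 0 + z 1 + z 2 + z 3 + z 4"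
    "z 0 + z 1 + z 2 + z 3 + z 4 = 3 \<Longrightarrow> (f 0 = 0 \<and> f 2 = 0) \<or> (f 1 = 0 \<and> f 3 = 0) \<or> (f 2 = 0 \<and> f 4 = 0) \<or> (f 3 = 0 \<and> f 0 = 0) \<or> (f 4 = 0 \<and> f 1 = 0)"
    using a by (auto simp: z_def split: if_splits)
  have "card {i\<in>{..<10}. \<mu> i \<noteq> 0} = (\<Sum>i<10. if \<mu> i \<noteq> 0 then 1 else 0)"
    by (simp add: sum.If_cases Int_def)
  also have "\<dots> = (\<Sum>i<10. z i)" by (intro sum.cong) (auto simp: f_def z_def)
  also have "\<dots> = z 0 + z 1 + z 2 + z 3 + z 4 + (z 5 + z 6 + z 7 + z 8 + z 9)" by (simp add: lessThan_10)
  also have "\<dots> \<ge> 7"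
  proof (rule ccontr)
    assume "\<not> 7 \<le> z 0 + z 1 + z 2 + z 3 + z 4 + (z 5 + z 6 + z 7 + z 8 + z 9)"
    then have "z 0 + z 1 + z 2 + z 3 + z 4 = 3" "z 5 + z 6 + z 7 + z 8 + z 9 = 3"
      using za(1) zu(1) by linarith+
    then show False using parity za(2) zu(2) by blast
  qed
  finally show ?thesis .
qed

lemma block_gen_height:
  assumes "i < 10"
  shows "(\<Sum>s<6. if s = 0 then 0 else block_gen i s) = 1"
proof -
  have "{..<6::nat} = {0,1,2,3,4,5}" by auto
  then have "(\<Sum>s<6. if s = 0 then 0 else block_gen i s)
      = block_gen i 1 + block_gen i 2 + block_gen i 3 + block_gen i 4 + block_gen i 5" by simp
  moreover have "i \<in> {0,1,2,3,4,5,6,7,8,9}" using assms lessThan_10 by blast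
  then have "block_gen i 1 + block_gen i 2 + block_gen i 3 + block_gen i 4 + block_gen i 5 = 1"
    by (elim insertE emptyE) (simp_all add: block_gen_def)
  ultimately show ?thesis by simp
qed

subsection \<open>Rationality of finitely generated cones\<close>

text \<open>A set of integer functionals can be filtered, united and recombined during elimination
  without renumbering rows.\<close>

lemma rational_cone_iff_finite:
  fixes C :: "(real ^ 'n::finite) set"
  shows "rational_cone C \<longleftrightarrow>
    (\<exists>F :: ('n \<Rightarrow> int) set. finite F \<and> C = {x. \<forall>a\<in>F. 0 \<le> (\<Sum>j\<in>UNIV. of_int (a j) * x $ j)})"
proof
  assume "rational_cone C"
  then obtain m and A :: "nat \<Rightarrow> 'n \<Rightarrow> int"
    where "C = {x. \<forall>i<m. (\<Sum>j\<in>UNIV. of_int (A i j) * x $ j) \<ge> 0}"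
    unfolding rational_cone_def by blast
  then show "\<exists>F :: ('n \<Rightarrow> int) set. finite F \<and> C = {x. \<forall>a\<in>F. 0 \<le> (\<Sum>j\<in>UNIV. of_int (a j) * x $ j)}"
    by (intro exI[of _ "A ` {..<m}"]) auto
next
  assume "\<exists>F :: ('n \<Rightarrow> int) set. finite F \<and> C = {x. \<forall>a\<in>F. 0 \<le> (\<Sum>j\<in>UNIV. of_int (a j) * x $ j)}"
  then obtain F :: "('n \<Rightarrow> int) set"
    where "finite F" and C: "C = {x. \<forall>a\<in>F. 0 \<le> (\<Sum>j\<in>UNIV. of_int (a j) * x $ j)}" by blast
  from finite_imp_nat_seg_image_inj_on[OF \<open>finite F\<close>]
  obtain m and A :: "nat \<Rightarrow> 'n \<Rightarrow> int" where "F = A ` {i. i < m}"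
    by blast
  then show "rational_cone C"
    unfolding rational_cone_def C by (intro exI[of _ m] exI[of _ A]) auto
qed

text \<open>Fourier--Motzkin elimination of the coefficient of \<open>v\<close>.\<close>

lemma rational_cone_add_ray:
  fixes C :: "(real ^ 'n::finite) set" and v :: "real ^ 'n"
  assumes "rational_cone C" and v: "\<And>j. v $ j \<in> \<int>"
  shows "rational_cone {x + t *\<^sub>R v | x t. x \<in> C \<and> 0 \<le> t}"
proof -
  obtain F :: "('n \<Rightarrow> int) set"
    where F: "finite F" and C: "C = {x. \<forall>a\<in>F. 0 \<le> (\<Sum>j\<in>UNIV. of_int (a j) * x $ j)}"
    using assms(1) unfolding rational_cone_iff_finite by blast
  define w where "w j = \<lfloor>v $ j\<rfloor>" for j
  have w: "v $ j = of_int (w j)" for j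
    using v[of j] by (simp add: w_def of_int_floor_cancel)
  define d where "d a = (\<Sum>j\<in>UNIV. a j * w j)" for a :: "'n \<Rightarrow> int"
  define e where "e a x = (\<Sum>j\<in>UNIV. of_int (a j) * x $ j)" for a :: "'n \<Rightarrow> int" and x :: "real ^ 'n"
  have e_v: "e a (x + t *\<^sub>R v) = e a x + t * d a" for a x t
    by (simp add: e_def d_def w algebra_simps sum.distrib sum_distrib_left)
  \<comment> \<open>For \<open>d a \<ge> 0 > d b\<close> this is a nonnegative combination of the
    two functionals, and it vanishes at \<open>v\<close>.\<close>
  define mix where "mix a b = (\<lambda>j. d a * b j - d b * a j)" for a b
  have e_mix: "e (mix a b) x = d a * e b x - d b * e a x" for a b x
    by (simp add: mix_def e_def algebra_simps sum_subtractf sum_distrib_left)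
  define F' where "F' = {a\<in>F. 0 \<le> d a} \<union> (\<lambda>(a, b). mix a b) ` ({a\<in>F. 0 \<le> d a} \<times> {b\<in>F. d b < 0})"
  have "finite F'" using F by (simp add: F'_def)
  moreover have "{x + t *\<^sub>R v | x t. x \<in> C \<and> 0 \<le> t} = {y. \<forall>a\<in>F'. 0 \<le> e a y}"
  proof (intro equalityI subsetI)
    fix y assume "y \<in> {x + t *\<^sub>R v | x t. x \<in> C \<and> 0 \<le> t}"
    then obtain x t where y: "y = x + t *\<^sub>R v" and x: "\<And>a. a \<in> F \<Longrightarrow> 0 \<le> e a x" and t: "0 \<le> t"
      by (auto simp: C e_def)
    have "0 \<le> e (mix a b) y" if "a \<in> F" "b \<in> F" "0 \<le> d a" "d b < 0" for a b
    proof -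
      have "e (mix a b) y = d a * e b x - d b * e a x" unfolding y e_mix unfolding e_v by (simp add: algebra_simps)
      moreover have "0 \<le> d a * e b x" "d b * e a x \<le> 0" using x that by (auto intro: mult_nonpos_nonneg)
      ultimately show ?thesis by linarith
    qed
    then show "y \<in> {y. \<forall>a\<in>F'. 0 \<le> e a y}"
      using x t by (auto simp: F'_def y e_v)
  next
    fix y assume "y \<in> {y. \<forall>a\<in>F'. 0 \<le> e a y}"
    then have F': "0 \<le> e a y" if "a \<in> F'" for a using that by blast
    have pos: "0 \<le> e a y" if "a \<in> F" "0 \<le> d a" for a
      using F'[of a] that by (simp add: F'_def)
    have mixed: "0 \<le> d a * e b y - d b * e a y" if "a \<in> F" "b \<in> F" "0 \<le> d a" "d b < 0" for a b
      using F'[of "mix a b"] that unfolding e_mix by (force simp: F'_def)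
    \<comment> \<open>A functional with \<open>d b < 0\<close> requires a subtracted multiple of
      \<open>v\<close> of at least \<open>e b y / d b\<close>; the element 0 keeps the multiple
      nonnegative. The maximum is thus the least admissible choice, and the functionals with
      \<open>d a \<ge> 0\<close> tolerate it by \<open>pos\<close> and \<open>mixed\<close>.\<close>
    define T where "T = insert 0 ((\<lambda>b. e b y / d b) ` {b\<in>F. d b < 0})"
    have T: "finite T" "T \<noteq> {}" using F by (auto simp: T_def)
    have t0: "0 \<le> Max T" using T by (intro Max_ge) (auto simp: T_def)
    have "0 \<le> e a (y - Max T *\<^sub>R v)" if "a \<in> F" for a
    proof -
      have e: "e a (y - Max T *\<^sub>R v) = e a y - Max T * d a" using e_v[of a y "- Max T"] by simp
      show ?thesis
      proof (cases "0 \<le> d a")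
        case True
        have "Max T \<in> T" using T by (rule Max_in)
        then consider "Max T = 0" | b where "b \<in> F" "d b < 0" "Max T = e b y / d b" by (auto simp: T_def)
        then show ?thesis
        proof cases
          case 1 then show ?thesis using pos[OF that True] e by simp
        next
          case 2
          have "e b y / d b * d a \<le> e a y" using mixed[OF that 2(1) True 2(2)] 2(2)
            by (simp add: field_simps)
          then show ?thesis using e 2 by simp
        qed
      next
        case False
        then have "e a y / d a \<le> Max T" using T that by (intro Max_ge) (auto simp: T_def)
        then have "Max T * d a \<le> e a y" using False by (simp add: field_simps)
        then show ?thesis using e by simp
      qed
    qed
    then have "y - Max T *\<^sub>R v \<in> C" by (simp add: C e_def)
    then show "y \<in> {x + t *\<^sub>R v | x t. x \<in> C \<and> 0 \<le> t}"
      using t0 by (intro CollectI exI[of _ "y - Max T *\<^sub>R v"] exI[of _ "Max T"]) simp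
  qed
  ultimately show ?thesis unfolding rational_cone_iff_finite e_def by blast
qed

lemma rational_cone_zero: "rational_cone {0 :: real ^ 'n::finite}"
proof -
  let ?F = "(\<lambda>(k, c). (\<lambda>j. if j = k then c else 0)) ` (UNIV \<times> {1, -1}) :: ('n \<Rightarrow> int) set"
  have single: "(\<Sum>j\<in>UNIV. of_int (if j = k then c else 0) * x $ j) = of_int c * x $ k" for k :: 'n and c :: int and x :: "real ^ 'n"
    by (simp add: if_distrib[of of_int] if_distrib[of "\<lambda>t. t * _"] cong: if_cong)
  have "{0} = {x :: real ^ 'n. \<forall>a\<in>?F. 0 \<le> (\<Sum>j\<in>UNIV. of_int (a j) * x $ j)}"
    by (auto simp: single vec_eq_iff order_antisym)
  moreover have "finite ?F" by simp
  ultimately show ?thesis unfolding rational_cone_iff_finite by blast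
qed

text \<open>Starting from the zero cone, the generators are added one ray at a time.\<close>

lemma rational_cone_generated:
  fixes v :: "'i \<Rightarrow> real ^ 'n::finite"
  assumes "finite I" and "\<And>i j. i \<in> I \<Longrightarrow> v i $ j \<in> \<int>"
  shows "rational_cone {\<Sum>i\<in>I. l i *\<^sub>R v i | l. \<forall>i\<in>I. 0 \<le> l i}"
  using assms
proof (induction I rule: finite_induct)
  case empty
  then show ?case by (simp add: rational_cone_zero)
next
  case (insert k I)
  let ?C = "{\<Sum>i\<in>I. l i *\<^sub>R v i | l. \<forall>i\<in>I. 0 \<le> l i}"
  have "{\<Sum>i\<in>insert k I. l i *\<^sub>R v i | l. \<forall>i\<in>insert k I. 0 \<le> l i}
    = {x + t *\<^sub>R v k | x t. x \<in> ?C \<and> 0 \<le> t}"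
  proof (intro equalityI subsetI)
    fix y assume "y \<in> {\<Sum>i\<in>insert k I. l i *\<^sub>R v i | l. \<forall>i\<in>insert k I. 0 \<le> l i}"
    then obtain l where "y = (\<Sum>i\<in>I. l i *\<^sub>R v i) + l k *\<^sub>R v k" "\<forall>i\<in>insert k I. 0 \<le> l i"
      using insert.hyps by (auto simp: add.commute)
    then show "y \<in> {x + t *\<^sub>R v k | x t. x \<in> ?C \<and> 0 \<le> t}" by blast
  next
    fix y assume "y \<in> {x + t *\<^sub>R v k | x t. x \<in> ?C \<and> 0 \<le> t}"
    then obtain l t where y: "y = (\<Sum>i\<in>I. l i *\<^sub>R v i) + t *\<^sub>R v k" and l: "\<forall>i\<in>I. 0 \<le> l i" "0 \<le> t" by blast
    have "(\<Sum>i\<in>I. (l(k := t)) i *\<^sub>R v i) = (\<Sum>i\<in>I. l i *\<^sub>R v i)"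
      using insert.hyps by (intro sum.cong) auto
    then have "y = (\<Sum>i\<in>insert k I. (l(k := t)) i *\<^sub>R v i)"
      using insert.hyps by (simp add: y)
    moreover have "\<forall>i\<in>insert k I. 0 \<le> (l(k := t)) i" using l by simp
    ultimately show "y \<in> {\<Sum>i\<in>insert k I. l i *\<^sub>R v i | l. \<forall>i\<in>insert k I. 0 \<le> l i}" by blast
  qed
  moreover have "rational_cone ?C" using insert by blast
  then have "rational_cone {x + t *\<^sub>R v k | x t. x \<in> ?C \<and> 0 \<le> t}"
    by (rule rational_cone_add_ray) (use insert.prems in blast)
  ultimately show ?case by (simp only:)
qed

section \<open>Counting lattice points in a box\<close>

lemma card_int_box_le:
  fixes X :: "(real ^ 'n::finite) set"
  assumes "\<And>x t. x \<in> X \<Longrightarrow> x $ t \<in> \<int> \<and> \<bar>x $ t\<bar> \<le> real K"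
  shows "finite X" "card X \<le> (2 * K + 1) ^ CARD('n)"
proof -
  let ?F = "PiE UNIV (\<lambda>_::'n. {- int K..int K})"
  let ?g = "\<lambda>f :: 'n \<Rightarrow> int. (\<chi> t. of_int (f t)) :: real ^ 'n"
  have sub: "X \<subseteq> ?g ` ?F"
  proof
    fix x assume x: "x \<in> X"
    have fl: "x $ t = of_int \<lfloor>x $ t\<rfloor>" for t
      using assms[OF x, of t] by (simp add: of_int_floor_cancel)
    have "\<lfloor>x $ t\<rfloor> \<in> {- int K..int K}" for t
      using assms[OF x, of t] fl[of t] by (simp add: abs_le_iff) linarith
    then have "(\<lambda>t. \<lfloor>x $ t\<rfloor>) \<in> ?F" by auto
    moreover have "x = ?g (\<lambda>t. \<lfloor>x $ t\<rfloor>)" using fl by (simp add: vec_eq_iff)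
    ultimately show "x \<in> ?g ` ?F" by (intro image_eqI[where x = "\<lambda>t. \<lfloor>x $ t\<rfloor>"])
  qed
  have fin: "finite ?F" by (intro finite_PiE) auto
  then show "finite X" using sub finite_subset by blast
  have "card X \<le> card (?g ` ?F)" using fin sub by (intro card_mono) auto
  also have "\<dots> \<le> card ?F" using fin by (rule card_image_le)
  also have "\<dots> = (2 * K + 1) ^ CARD('n)" by (simp add: card_PiE nat_add_distrib nat_mult_distrib)
  finally show "card X \<le> (2 * K + 1) ^ CARD('n)" .
qed

subsection \<open>The product cone and its Hilbert basis\<close>

text \<open>Coordinate \<open>t\<close> is coordinate \<open>pos t mod 6\<close> of block \<open>pos t div 6\<close>; the last, shorter block \<open>q\<close> is the orthant.\<close>

locale block_cone =
  fixes pos :: "'n::finite \<Rightarrow> nat" and q r :: nat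
  assumes bij_pos: "bij_betw pos UNIV {..<6 * q + r}" and r_less: "r < 6"
begin

text \<open>Meaningful only for \<open>6 * j + s < 6 * q + r\<close>; the block number
  \<open>j = q\<close> addresses the orthant.\<close>

definition crd :: "nat \<Rightarrow> nat \<Rightarrow> 'n" where
  "crd j s = inv pos (6 * j + s)"

lemma pos_crd: "6 * j + s < 6 * q + r \<Longrightarrow> pos (crd j s) = 6 * j + s"
  using bij_pos unfolding crd_def bij_betw_def by (intro f_inv_into_f) auto

lemma pos_crd_block: "j < q \<Longrightarrow> s < 6 \<Longrightarrow> pos (crd j s) = 6 * j + s"
  by (rule pos_crd) simp

lemma crd_pos: "crd (pos t div 6) (pos t mod 6) = t"
  using bij_pos by (simp add: crd_def bij_betw_def)

lemma crd_eq_iff: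
  assumes "6 * j + s < 6 * q + r" "6 * j' + s' < 6 * q + r"
  shows "crd j s = crd j' s' \<longleftrightarrow> 6 * j + s = 6 * j' + s'"
  using pos_crd[OF assms(1)] pos_crd[OF assms(2)] unfolding crd_def by metis

lemma crd_block_eq_iff:
  assumes "j < q" "s < 6" "j' < q" "s' < 6"
  shows "crd j s = crd j' s' \<longleftrightarrow> j = j' \<and> s = s'"
proof -
  have "crd j s = crd j' s' \<longleftrightarrow> 6 * j + s = 6 * j' + s'" using assms by (intro crd_eq_iff) auto
  moreover have "6 * j + s = 6 * j' + s' \<longleftrightarrow> j = j' \<and> s = s'"
    using assms(2,4) by presburger
  ultimately show ?thesis by simp
qed

lemma crd_cases:
  obtains (block) j s where "j < q" "s < 6" "t = crd j s" | (rest) i where "i < r" "t = crd q i"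
proof -
  have less: "pos t < 6 * q + r" using bij_pos by (auto simp: bij_betw_def)
  show thesis
  proof (cases "pos t div 6 < q")
    case True
    then show thesis using block[of "pos t div 6" "pos t mod 6"] crd_pos[of t] by simp
  next
    case False
    then have "pos t div 6 = q" using less r_less by linarith
    moreover from this have "pos t mod 6 < r" using less by presburger
    ultimately show thesis using rest[of "pos t mod 6"] crd_pos[of t] by simp
  qed
qed

definition idx :: "(nat \<times> nat) set" where
  "idx = {..<q} \<times> {..<10} \<union> {q} \<times> {..<r}"

definition gen :: "nat \<times> nat \<Rightarrow> real ^ 'n" where
  "gen = (\<lambda>(j, i). \<chi> t. if pos t div 6 \<noteq> j then 0
     else if j < q then of_int (block_gen i (pos t mod 6)) else of_bool (i = pos t mod 6))"

lemma finite_idx [simp]: "finite idx"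
  by (simp add: idx_def)

lemma idx_simps: "j < q \<Longrightarrow> (j, i) \<in> idx \<longleftrightarrow> i < 10" "(q, i) \<in> idx \<longleftrightarrow> i < r"
  by (auto simp: idx_def)

lemma sum_idx: "sum f idx = (\<Sum>j<q. \<Sum>i<10. f (j, i)) + (\<Sum>i<r. f (q, i))"
proof -
  have "sum f idx = sum f ({..<q} \<times> {..<10}) + sum f ({q} \<times> {..<r})"
    unfolding idx_def by (rule sum.union_disjoint) auto
  also have "sum f ({..<q} \<times> {..<10}) = (\<Sum>j<q. \<Sum>i<10. f (j, i))"
    unfolding sum.cartesian_product by simp
  also have "sum f ({q} \<times> {..<r}) = (\<Sum>j\<in>{q}. \<Sum>i<r. f (j, i))"
    unfolding sum.cartesian_product by simp
  finally show ?thesis by simp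
qed

lemma gen_block:
  assumes "j < q" "s < 6"
  shows "gen (j', i) $ crd j s = (if j' = j then of_int (block_gen i s) else 0)"
  using assms by (simp add: gen_def pos_crd_block)

lemma gen_rest:
  assumes "k < r"
  shows "gen (j, i) $ crd q k = of_bool (j = q \<and> i = k)"
  using assms r_less by (auto simp: gen_def pos_crd)

lemma sum_gen_block:
  assumes "j < q" "s < 6"
  shows "(\<Sum>p\<in>idx. l p *\<^sub>R gen p) $ crd j s = (\<Sum>i<10. l (j, i) * of_int (block_gen i s))"
proof -
  have "(\<Sum>p\<in>idx. l p *\<^sub>R gen p) $ crd j s
    = (\<Sum>j'<q. \<Sum>i<10. l (j', i) * (if j' = j then of_int (block_gen i s) else 0))"
    using assms by (simp add: sum_idx gen_block)
  also have "\<dots> = (\<Sum>j'<q. if j' = j then \<Sum>i<10. l (j', i) * of_int (block_gen i s) else 0)"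
    by (intro sum.cong) auto
  also have "\<dots> = (\<Sum>i<10. l (j, i) * of_int (block_gen i s))" using assms by simp
  finally show ?thesis .
qed

lemma sum_gen_rest:
  assumes "k < r"
  shows "(\<Sum>p\<in>idx. l p *\<^sub>R gen p) $ crd q k = l (q, k)"
proof -
  have "(\<Sum>p\<in>idx. l p *\<^sub>R gen p) $ crd q k = (\<Sum>i<r. if i = k then l (q, i) else 0)"
    using assms by (auto simp: sum_idx gen_rest intro!: sum.cong)
  then show ?thesis using assms by simp
qed

lemma sum_gen_eqI:
  assumes "\<And>j s. j < q \<Longrightarrow> s < 6 \<Longrightarrow> (\<Sum>i<10. l (j, i) * of_int (block_gen i s)) = x $ crd j s"
    and "\<And>k. k < r \<Longrightarrow> l (q, k) = x $ crd q k"
  shows "(\<Sum>p\<in>idx. l p *\<^sub>R gen p) = x"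
  unfolding vec_eq_iff
proof
  fix t show "(\<Sum>p\<in>idx. l p *\<^sub>R gen p) $ t = x $ t"
  proof (cases t rule: crd_cases)
    case (block j s)
    then show ?thesis by (simp only: sum_gen_block assms(1))
  next
    case (rest k)
    then show ?thesis by (simp only: sum_gen_rest assms(2))
  qed
qed

lemma gen_Ints: "gen p $ t \<in> \<int>"
  by (cases p) (simp add: gen_def of_bool_def)

definition C :: "(real ^ 'n) set" where
  "C = {\<Sum>p\<in>idx. l p *\<^sub>R gen p | l. \<forall>p\<in>idx. 0 \<le> l p}"

lemma rational_cone_C: "rational_cone C"
  unfolding C_def by (rule rational_cone_generated[OF finite_idx gen_Ints])

section \<open>A grading, pointedness and dimension\<close>

text \<open>The linear functional that sums all coordinates except the \<open>m\<close> of each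
  block. It is 1 on every generator, since a pentagon generator has c-entries -1, 1, 1.\<close>

definition height :: "real ^ 'n \<Rightarrow> real" where
  "height x = (\<Sum>t\<in>UNIV. if pos t div 6 < q \<and> pos t mod 6 = 0 then 0 else x $ t)"

lemma height_gen:
  assumes "p \<in> idx"
  shows "height (gen p) = 1"
proof -
  obtain j i where p: "p = (j, i)" by (cases p)
  from assms consider (block) "j < q" "i < 10" | (rest) "j = q" "i < r"
    by (auto simp: p idx_def)
  then show ?thesis
  proof cases
    case block
    have "height (gen p) = (\<Sum>t\<in>crd j ` {..<6}. if pos t mod 6 = 0 then 0 else of_int (block_gen i (pos t mod 6)))"
      unfolding height_def p gen_def using block crd_pos
      by (intro sum.mono_neutral_cong_right) (auto simp: image_iff pos_crd_block, metis lessThan_iff mod_less_divisor zero_less_numeral)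
    also have "\<dots> = (\<Sum>s<6. if s = 0 then 0 else of_int (block_gen i s))"
      using block by (subst sum.reindex) (auto simp: inj_on_def crd_eq_iff pos_crd_block intro!: sum.cong)
    also have "\<dots> = of_int (\<Sum>s<6. if s = 0 then 0 else block_gen i s)"
      unfolding of_int_sum by (intro sum.cong) auto
    also have "\<dots> = 1" using block by (simp add: block_gen_height)
    finally show ?thesis .
  next
    case rest
    have "height (gen p) = (\<Sum>t\<in>{crd q i}. 1)"
      unfolding height_def p using rest r_less crd_pos
      by (intro sum.mono_neutral_cong_right) (auto simp: gen_def pos_crd)
    then show ?thesis by simp
  qed
qed

lemma height_sum_gen: "height (\<Sum>p\<in>idx. l p *\<^sub>R gen p) = (\<Sum>p\<in>idx. l p)"
proof -
  have "height (\<Sum>p\<in>idx. l p *\<^sub>R gen p) = (\<Sum>t\<in>UNIV. \<Sum>p\<in>idx. l p * (if pos t div 6 < q \<and> pos t mod 6 = 0 then 0 else gen p $ t))"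
    unfolding height_def by (intro sum.cong) (auto simp: sum_component)
  also have "\<dots> = (\<Sum>p\<in>idx. l p * height (gen p))"
    unfolding height_def sum_distrib_left by (rule sum.swap)
  also have "\<dots> = (\<Sum>p\<in>idx. l p)" by (simp add: height_gen)
  finally show ?thesis .
qed

lemma height_sum: "height (\<Sum>h\<in>H. c h *\<^sub>R h) = (\<Sum>h\<in>H. c h * height h)"
proof -
  have "height (\<Sum>h\<in>H. c h *\<^sub>R h) = (\<Sum>t\<in>UNIV. \<Sum>h\<in>H. c h * (if pos t div 6 < q \<and> pos t mod 6 = 0 then 0 else h $ t))"
    unfolding height_def by (intro sum.cong) (auto simp: sum_component)
  also have "\<dots> = (\<Sum>h\<in>H. c h * height h)"
    unfolding height_def sum_distrib_left by (rule sum.swap)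
  finally show ?thesis .
qed

lemma height_0 [simp]: "height 0 = 0"
  unfolding height_def by (intro sum.neutral) auto

lemma height_uminus: "height (- x) = - height x"
  unfolding height_def sum_negf[symmetric] by (intro sum.cong) auto

text \<open>The height of a cone point is the sum of its nonnegative multipliers, so it vanishes
  only if all of them do.\<close>

lemma C_height:
  assumes "x \<in> C"
  shows "0 \<le> height x" and "height x = 0 \<Longrightarrow> x = 0"
proof -
  from assms obtain l where x: "x = (\<Sum>p\<in>idx. l p *\<^sub>R gen p)" and l: "\<And>p. p \<in> idx \<Longrightarrow> 0 \<le> l p"
    by (auto simp: C_def)
  show "0 \<le> height x" by (simp add: x height_sum_gen l sum_nonneg)
  assume "height x = 0"
  then have "\<forall>p\<in>idx. l p = 0" using l by (simp add: x height_sum_gen sum_nonneg_eq_0_iff)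
  then show "x = 0" by (simp add: x)
qed

lemma pointed_C: "pointed C"
proof -
  have "x = 0" if "x \<in> C" "- x \<in> C" for x
    using C_height[OF that(1)] C_height(1)[OF that(2)] by (simp add: height_uminus)
  moreover have "0 \<in> C" unfolding C_def by (intro CollectI exI[of _ "\<lambda>_. 0"]) simp
  ultimately show ?thesis unfolding pointed_def by force
qed

lemma gen_in_int_points:
  assumes "p \<in> idx"
  shows "gen p \<in> int_points C"
proof -
  have "gen p = (\<Sum>k\<in>idx. of_bool (k = p) *\<^sub>R gen k)"
    using assms by (simp add: of_bool_def if_distrib[of "\<lambda>c. c *\<^sub>R _"] cong: if_cong)
  then have "gen p \<in> C" unfolding C_def by (intro CollectI exI[of _ "\<lambda>k. of_bool (k = p)"]) auto
  then show ?thesis by (simp add: int_points_def gen_Ints)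
qed

lemma dim_C: "dim C = CARD('n)"
proof -
  have gen: "gen p \<in> span C" if "p \<in> idx" for p
    using gen_in_int_points[OF that] by (auto simp: int_points_def intro: span_base)
  have sum: "(\<Sum>p\<in>idx. l p *\<^sub>R gen p) \<in> span C" for l
    by (intro span_sum span_scale gen)
  have axis: "axis t 1 \<in> span C" for t
  proof (cases t rule: crd_cases)
    case (block j s)
    have "\<exists>l :: nat \<Rightarrow> real. \<forall>s'<6. (\<Sum>i<10. l i * of_int (block_gen i s')) = of_bool (s' = s)"
    proof (cases "s = 0")
      case True
      show ?thesis
      \<comment> \<open>The pentagon generator of vertex 0 becomes the \<open>m\<close>-axis once
        its c-entries -1, 1, 1 at vertices 0, 1, 4 are cancelled by unit vectors.\<close>
      proof (intro exI[of _ "\<lambda>i. of_bool (i = 5) + of_bool (i = 0) - of_bool (i = 1) - of_bool (i = 4)"] allI impI)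
        fix s' :: nat assume "s' < 6"
        then show "(\<Sum>i<10. (of_bool (i = 5) + of_bool (i = 0) - of_bool (i = 1) - of_bool (i = 4) :: real)
          * of_int (block_gen i s')) = of_bool (s' = s)"
          unfolding less_6_iff by (elim disjE) (simp_all only: block_gen_sum, simp_all add: True)
      qed
    next
      case False
      show ?thesis
      proof (intro exI[of _ "\<lambda>i. of_bool (i + 1 = s)"] allI impI)
        fix s' :: nat assume "s' < 6"
        then show "(\<Sum>i<10. (of_bool (i + 1 = s) :: real) * of_int (block_gen i s')) = of_bool (s' = s)"
          using block(2) False unfolding less_6_iff[of s']
          by (elim disjE) (simp_all only: block_gen_sum, auto simp: of_bool_def)
      qed
    qed
    then obtain l :: "nat \<Rightarrow> real"
      where l: "\<And>s'. s' < 6 \<Longrightarrow> (\<Sum>i<10. l i * of_int (block_gen i s')) = of_bool (s' = s)" by blast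
    have "(\<Sum>p\<in>idx. (of_bool (fst p = j) * l (snd p)) *\<^sub>R gen p) = axis t 1"
    proof (rule sum_gen_eqI)
      fix j' s' :: nat assume less: "j' < q" "s' < 6"
      then have "axis t (1::real) $ crd j' s' = of_bool (j' = j \<and> s' = s)"
        using block by (auto simp: axis_def crd_block_eq_iff)
      moreover have "(\<Sum>i<10. of_bool (j' = j) * l i * of_int (block_gen i s')) = of_bool (j' = j) * of_bool (s' = s)"
        using l[OF less(2)] by (simp add: sum_distrib_left[symmetric] mult.assoc)
      ultimately show "(\<Sum>i<10. of_bool (fst (j', i) = j) * l (snd (j', i)) * of_int (block_gen i s')) = axis t 1 $ crd j' s'"
        by simp
    next
      fix k assume "k < r"
      then show "of_bool (fst (q, k) = j) * l (snd (q, k)) = axis t (1::real) $ crd q k"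
        using block by (simp add: axis_def crd_eq_iff)
    qed
    then show ?thesis using sum by metis
  next
    case (rest k)
    moreover from this have "k < 6" using r_less by simp
    ultimately have "gen (q, k) = axis t 1"
      by (auto simp: vec_eq_iff gen_def axis_def crd_pos pos_crd of_bool_def)
    then show ?thesis using gen[of "(q, k)"] rest by (simp add: idx_simps)
  qed
  have "(UNIV :: (real ^ 'n) set) \<subseteq> span C"
  proof (intro subsetI)
    fix x :: "real ^ 'n"
    have "x = (\<Sum>t\<in>UNIV. x $ t *\<^sub>R axis t 1)"
      using basis_expansion[of x] by (simp add: scalar_mult_eq_scaleR)
    also have "\<dots> \<in> span C" using axis by (intro span_sum span_scale)
    finally show "x \<in> span C" .
  qed
  then have "dim C = DIM(real ^ 'n)" by (metis dim_UNIV dim_span top.extremum_uniqueI)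
  then show ?thesis by simp
qed

section \<open>Integer points and the Hilbert basis\<close>

text \<open>Each block is rounded separately by \<open>block_rounding\<close>; on the orthant the
  multipliers are coordinates of \<open>x\<close> and so already integral.\<close>

lemma int_points_rep:
  assumes "x \<in> int_points C"
  obtains \<mu> :: "nat \<times> nat \<Rightarrow> nat" where "x = (\<Sum>p\<in>idx. real (\<mu> p) *\<^sub>R gen p)"
proof -
  from assms obtain l where x: "x = (\<Sum>p\<in>idx. l p *\<^sub>R gen p)" and l: "\<And>p. p \<in> idx \<Longrightarrow> 0 \<le> l p"
    and int: "\<And>t. x $ t \<in> \<int>"
    by (auto simp: C_def int_points_def)
  have "\<exists>\<mu>::nat \<Rightarrow> nat. \<forall>s<6. (\<Sum>i<10. real (\<mu> i) * of_int (block_gen i s)) = x $ crd j s" if "j < q" for j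
  proof -
    have sums: "(\<Sum>i<10. l (j, i) * of_int (block_gen i s)) = x $ crd j s" if "s < 6" for s
      unfolding x sum_gen_block[OF \<open>j < q\<close> that] ..
    show ?thesis
      using block_rounding[of "\<lambda>i. l (j, i)"] sums l int that by (simp add: idx_simps)
  qed
  then have "\<forall>j. \<exists>\<mu>::nat \<Rightarrow> nat. j < q \<longrightarrow> (\<forall>s<6. (\<Sum>i<10. real (\<mu> i) * of_int (block_gen i s)) = x $ crd j s)"
    by blast
  from choice[OF this] obtain \<mu> :: "nat \<Rightarrow> nat \<Rightarrow> nat"
    where \<mu>: "\<And>j s. j < q \<Longrightarrow> s < 6 \<Longrightarrow> (\<Sum>i<10. real (\<mu> j i) * of_int (block_gen i s)) = x $ crd j s"
    by blast
  define \<nu> where "\<nu> p = (if fst p < q then \<mu> (fst p) (snd p) else nat \<lfloor>l p\<rfloor>)" for p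
  have "real (\<nu> (q, k)) = x $ crd q k" if "k < r" for k
  proof -
    have "l (q, k) = x $ crd q k" unfolding x sum_gen_rest[OF that] ..
    then show ?thesis
      using that l[of "(q, k)"] int[of "crd q k"] by (simp add: \<nu>_def idx_simps of_int_floor_cancel)
  qed
  then have "(\<Sum>p\<in>idx. real (\<nu> p) *\<^sub>R gen p) = x"
    by (intro sum_gen_eqI) (simp_all add: \<mu> \<nu>_def)
  from this[symmetric] show thesis by (rule that)
qed

text \<open>With natural multipliers the height is a natural number, and in the cone only 0 has
  height 0.\<close>

lemma int_points_height_ge_1:
  assumes "x \<in> int_points C" "x \<noteq> 0"
  shows "1 \<le> height x"
proof -
  obtain \<mu> where x: "x = (\<Sum>p\<in>idx. real (\<mu> p) *\<^sub>R gen p)" using int_points_rep[OF assms(1)] .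
  define N where "N = (\<Sum>p\<in>idx. \<mu> p)"
  have N: "height x = real N" by (simp add: x height_sum_gen N_def)
  have "height x \<noteq> 0" using C_height(2) assms by (auto simp: int_points_def)
  then show ?thesis using N by simp
qed

lemma generates_gen: "generates (gen ` idx) (int_points C)"
  unfolding generates_def
proof (intro conjI ballI)
  fix x assume "x \<in> int_points C"
  then obtain \<mu> where x: "x = (\<Sum>p\<in>idx. real (\<mu> p) *\<^sub>R gen p)" by (rule int_points_rep)
  also have "\<dots> = (\<Sum>g\<in>gen ` idx. \<Sum>p | p \<in> idx \<and> gen p = g. real (\<mu> p) *\<^sub>R gen p)"
    by (rule sum.image_gen) simp
  also have "\<dots> = (\<Sum>g\<in>gen ` idx. real (\<Sum>p | p \<in> idx \<and> gen p = g. \<mu> p) *\<^sub>R g)"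
    by (intro sum.cong refl) (simp add: scaleR_sum_left)
  finally show "\<exists>c. x = (\<Sum>h\<in>gen ` idx. real (c h) *\<^sub>R h)"
    by (rule exI[of _ "\<lambda>g. \<Sum>p | p \<in> idx \<and> gen p = g. \<mu> p"])
qed (auto intro: gen_in_int_points)

text \<open>Every generator has height 1, the least height of a non-zero lattice point, so it is irreducible.\<close>

lemma generates_superset:
  assumes H: "generates H (int_points C)"
  shows "gen ` idx \<subseteq> H"
proof
  fix g assume "g \<in> gen ` idx"
  then obtain p where p: "p \<in> idx" "g = gen p" by blast
  have fin: "finite H" and sub: "H \<subseteq> int_points C" using H by (auto simp: generates_def)
  obtain c :: "real ^ 'n \<Rightarrow> nat" where g: "g = (\<Sum>h\<in>H. real (c h) *\<^sub>R h)"
    using H gen_in_int_points[OF p(1)] p(2) by (auto simp: generates_def)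
  have nonneg: "0 \<le> height h" if "h \<in> H" for h
    using that sub C_height(1) by (auto simp: int_points_def)
  have one: "(\<Sum>h\<in>H. real (c h) * height h) = 1"
    using height_gen[OF p(1)] by (simp add: p(2)[symmetric] g height_sum)
  then have "\<exists>h\<in>H. real (c h) * height h \<noteq> 0"
    using sum.neutral[of H "\<lambda>h. real (c h) * height h"] by force
  then obtain h where h: "h \<in> H" "real (c h) * height h \<noteq> 0" by blast
  then have "h \<noteq> 0" by auto
  then have ge: "1 \<le> height h" using h sub int_points_height_ge_1 by blast
  have split: "real (c h) * height h + (\<Sum>h'\<in>H - {h}. real (c h') * height h') = 1"
    using one fin h by (simp add: sum.remove)
  have rest: "0 \<le> (\<Sum>h'\<in>H - {h}. real (c h') * height h')"
    using nonneg by (intro sum_nonneg) auto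
  have c1: "1 \<le> real (c h)" using h(2) by (cases "c h") auto
  have "real (c h) * 1 \<le> real (c h) * height h" using ge by (intro mult_left_mono) auto
  \<comment> \<open>The term of \<open>h\<close> is at least 1 and the rest is nonnegative, so a
    total of 1 leaves a single copy of \<open>h\<close> and nothing else.\<close>
  then have "real (c h) = 1" and "(\<Sum>h'\<in>H - {h}. real (c h') * height h') = 0"
    using split rest c1 by linarith+
  then have ch: "c h = 1" and "(\<Sum>h'\<in>H - {h}. real (c h') * height h') = 0" by simp_all
  then have zero: "\<forall>h'\<in>H - {h}. real (c h') * height h' = 0"
    using fin nonneg by (subst (asm) sum_nonneg_eq_0_iff) auto
  have "real (c h') *\<^sub>R h' = 0" if "h' \<in> H - {h}" for h'
  proof (cases "c h' = 0")
    case False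
    moreover have "real (c h') * height h' = 0" using zero that by blast
    ultimately have "height h' = 0" by simp
    then show ?thesis using sub that C_height(2) by (auto simp: int_points_def)
  qed simp
  then have "(\<Sum>h'\<in>H - {h}. real (c h') *\<^sub>R h') = 0" by (rule sum.neutral[rule_format])
  then have "g = h" using fin h ch by (simp add: g sum.remove)
  then show "g \<in> H" using h by simp
qed

text \<open>The generators form a generating set contained in every other one, so it is the only
  inclusion-minimal one and \<open>THE\<close> is determined.\<close>

lemma hilbert_basis_C: "hilbert_basis C = gen ` idx"
  unfolding hilbert_basis_def
proof (rule the_equality)
  show "generates (gen ` idx) (int_points C) \<and> (\<forall>H'\<subset>gen ` idx. \<not> generates H' (int_points C))"
    using generates_gen by (auto dest: generates_superset)
  fix H assume H: "generates H (int_points C) \<and> (\<forall>H'\<subset>H. \<not> generates H' (int_points C))"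
  then have "gen ` idx \<subseteq> H" by (intro generates_superset) (rule conjunct1)
  moreover have "\<not> gen ` idx \<subset> H" using H generates_gen by metis
  ultimately show "H = gen ` idx" by (simp add: psubset_eq)
qed

section \<open>Hilbert length as support size\<close>

text \<open>Provides a candidate for the \<open>LEAST\<close> in \<open>hilbert_length\<close>, so
  that the minimum is attained and bounded; coefficients may be 0.\<close>

lemma hilbert_rep:
  assumes "x \<in> int_points C"
  shows "\<exists>(h :: nat \<Rightarrow> real ^ 'n) (c :: nat \<Rightarrow> nat).
    (\<forall>i\<in>{1..card (gen ` idx)}. h i \<in> hilbert_basis C) \<and> x = (\<Sum>i=1..card (gen ` idx). real (c i) *\<^sub>R h i)"
proof -
  obtain h where h: "bij_betw h {1..card (gen ` idx)} (gen ` idx)"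
    using ex_bij_betw_nat_finite_1[of "gen ` idx"] by auto
  obtain c :: "real ^ 'n \<Rightarrow> nat" where "x = (\<Sum>g\<in>gen ` idx. real (c g) *\<^sub>R g)"
    using generates_gen assms unfolding generates_def by blast
  then have "x = (\<Sum>i=1..card (gen ` idx). real (c (h i)) *\<^sub>R h i)"
    using sum.reindex_bij_betw[OF h, of "\<lambda>g. real (c g) *\<^sub>R g"] by simp
  moreover have "\<forall>i\<in>{1..card (gen ` idx)}. h i \<in> hilbert_basis C"
    unfolding hilbert_basis_C using bij_betwE[OF h] .
  ultimately show ?thesis by (intro exI[of _ h] exI[of _ "\<lambda>i. c (h i)"] conjI)
qed

lemma hilbert_length_le: "x \<in> int_points C \<Longrightarrow> hilbert_length C x \<le> card (gen ` idx)"
  unfolding hilbert_length_def using hilbert_rep by (rule Least_le)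

text \<open>A shortest representation is a list of vectors, possibly with repetitions. Choosing an
  index for each entry and adding the coefficients per index cannot give more than \<open>l\<close>
  nonzero multipliers.\<close>

lemma hilbert_length_support:
  assumes "x \<in> int_points C"
  obtains \<mu> :: "nat \<times> nat \<Rightarrow> nat"
  where "x = (\<Sum>p\<in>idx. real (\<mu> p) *\<^sub>R gen p)" "card {p\<in>idx. \<mu> p \<noteq> 0} \<le> hilbert_length C x"
proof -
  define l where "l = hilbert_length C x"
  have "\<exists>(h :: nat \<Rightarrow> real ^ 'n) (c :: nat \<Rightarrow> nat).
      (\<forall>i\<in>{1..l}. h i \<in> hilbert_basis C) \<and> x = (\<Sum>i=1..l. real (c i) *\<^sub>R h i)"
    unfolding l_def hilbert_length_def by (rule LeastI_ex) (use hilbert_rep[OF assms] in blast)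
  then obtain h :: "nat \<Rightarrow> real ^ 'n" and c :: "nat \<Rightarrow> nat"
    where hc: "(\<forall>i\<in>{1..l}. h i \<in> hilbert_basis C) \<and> x = (\<Sum>i=1..l. real (c i) *\<^sub>R h i)"
    by blast
  then have h: "h i \<in> gen ` idx" if "i \<in> {1..l}" for i using that hilbert_basis_C by blast
  have x: "x = (\<Sum>i=1..l. real (c i) *\<^sub>R h i)" using hc by blast
  from h have "\<forall>i. \<exists>p. i \<in> {1..l} \<longrightarrow> p \<in> idx \<and> gen p = h i" by (metis imageE)
  then obtain P where P: "\<And>i. i \<in> {1..l} \<Longrightarrow> P i \<in> idx \<and> gen (P i) = h i" by metis
  define \<mu> where "\<mu> p = (\<Sum>i | i \<in> {1..l} \<and> P i = p. c i)" for p
  have "x = (\<Sum>i\<in>{1..l}. real (c i) *\<^sub>R gen (P i))" using P by (simp add: x)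
  also have "\<dots> = (\<Sum>p\<in>idx. \<Sum>i | i \<in> {1..l} \<and> P i = p. real (c i) *\<^sub>R gen (P i))"
    using P by (intro sum.group[symmetric]) auto
  also have "\<dots> = (\<Sum>p\<in>idx. real (\<mu> p) *\<^sub>R gen p)"
    by (intro sum.cong refl) (simp add: \<mu>_def scaleR_sum_left)
  finally have "x = (\<Sum>p\<in>idx. real (\<mu> p) *\<^sub>R gen p)" .
  moreover have "card {p\<in>idx. \<mu> p \<noteq> 0} \<le> l"
  proof -
    have "p \<in> P ` {1..l}" if "\<mu> p \<noteq> 0" for p
    proof (rule ccontr)
      assume "p \<notin> P ` {1..l}"
      then have "{i. i \<in> {1..l} \<and> P i = p} = {}" by blast
      then have "\<mu> p = 0" by (simp only: \<mu>_def sum.empty)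
      with that show False by contradiction
    qed
    then have "{p\<in>idx. \<mu> p \<noteq> 0} \<subseteq> P ` {1..l}" unfolding subset_iff mem_Collect_eq by metis
    then have "card {p\<in>idx. \<mu> p \<noteq> 0} \<le> card (P ` {1..l})" by (intro card_mono) auto
    also have "\<dots> \<le> l" using card_image_le[of "{1..l}" P] by simp
    finally show ?thesis .
  qed
  ultimately show thesis unfolding l_def by (rule that)
qed

subsection \<open>Points of large Hilbert length\<close>

lemma box_points_C:
  shows "finite (box_points (int_points C) (real K))"
    and "card (box_points (int_points C) (real K)) \<le> (2 * K + 1) ^ CARD('n)"
proof -
  have box: "x $ t \<in> \<int> \<and> \<bar>x $ t\<bar> \<le> real K" if "x \<in> box_points (int_points C) (real K)" for x t
  proof -
    have "- real K \<le> x $ t" "x $ t \<le> real K"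
      using that by (simp_all add: box_points_def mem_box_cart)
    then show ?thesis using that by (simp add: box_points_def int_points_def abs_le_iff)
  qed
  show "finite (box_points (int_points C) (real K))"
    "card (box_points (int_points C) (real K)) \<le> (2 * K + 1) ^ CARD('n)"
    using card_int_box_le[where X = "box_points (int_points C) (real K)", OF box] by blast+
qed

text \<open>
  In each block, \<open>m - 1\<close> and \<open>c\<close> are six times a point in a box of side \<open>L\<close> at \<open>3 L (5, 2, 2, 2, 2, 2)\<close>;
  the factor 3 keeps the box in the region where \<open>block_support\<close> applies.
\<close>

definition far_point :: "nat \<Rightarrow> ('n \<Rightarrow> nat) \<Rightarrow> real ^ 'n" where
  "far_point L f = (\<chi> t. real (if pos t div 6 < q then if pos t mod 6 = 0 then 6 * (15 * L + f t) + 1 else 6 * (6 * L + f t)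
     else f t + 1))"

lemma far_point_block_0: "j < q \<Longrightarrow> far_point L f $ crd j 0 = real (6 * (15 * L + f (crd j 0)) + 1)"
  using pos_crd_block[of j 0] by (simp add: far_point_def)

lemma far_point_block: "j < q \<Longrightarrow> 0 < s \<Longrightarrow> s < 6 \<Longrightarrow> far_point L f $ crd j s = real (6 * (6 * L + f (crd j s)))"
  by (simp add: far_point_def pos_crd_block)

lemma far_point_rest: "k < r \<Longrightarrow> far_point L f $ crd q k = real (f (crd q k) + 1)"
  by (simp add: far_point_def pos_crd)

lemma inj_far_point: "inj_on (far_point L) F"
proof (rule inj_onI)
  fix f g assume eq: "far_point L f = far_point L g"
  have "f t = g t" for t
    using arg_cong[OF eq, of "\<lambda>x. x $ t"] unfolding far_point_def vec_lambda_beta of_nat_eq_iff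
    by (cases "pos t div 6 < q"; cases "pos t mod 6 = 0"; simp)
  then show "f = g" ..
qed

text \<open>The largest entries are the \<open>m\<close>-coordinates, which stay below
  \<open>96 * L + 1\<close>.\<close>

lemma far_point_bounds:
  assumes "\<And>t. f t < L"
  shows "\<bar>far_point L f $ t\<bar> \<le> real (97 * L)"
proof -
  have "f t + 1 \<le> L" using assms[of t] by linarith
  then have "(if pos t div 6 < q then if pos t mod 6 = 0 then 6 * (15 * L + f t) + 1 else 6 * (6 * L + f t)
     else f t + 1) \<le> 97 * L" by (cases "pos t div 6 < q"; cases "pos t mod 6 = 0"; simp)
  then show ?thesis unfolding far_point_def by (simp only: vec_lambda_beta abs_of_nat of_nat_le_iff)
qed

lemma far_point_in_int_points:
  assumes f: "\<And>t. f t < L"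
  shows "far_point L f \<in> int_points C"
proof -
  define x where "x = far_point L f"
  \<comment> \<open>Every pentagon vertex receives one fifth of \<open>m\<close>. Two neighbours
    minus the vertex itself again give \<open>m / 5\<close>, so \<open>c - m / 5\<close> is left for
    the unit vector; it is nonnegative because c is at least \<open>36 * L\<close> and
    \<open>m\<close> is below \<open>96 * L + 1\<close>.\<close>
  define l where "l = (\<lambda>(j, i). if j < q then if i < 5 then x $ crd j (i + 1) - x $ crd j 0 / 5 else x $ crd j 0 / 5 else x $ crd q i)"
  have "(\<Sum>p\<in>idx. l p *\<^sub>R gen p) = x"
  proof (rule sum_gen_eqI)
    fix j s :: nat assume j: "j < q" and s: "s < 6"
    then show "(\<Sum>i<10. l (j, i) * of_int (block_gen i s)) = x $ crd j s"
      unfolding less_6_iff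
      by (elim disjE) (simp_all only: block_gen_sum, simp_all add: l_def numeral_eq_Suc)
  qed (simp add: l_def)
  moreover have "0 \<le> l p" if p: "p \<in> idx" for p
  proof -
    obtain j i where ji: "p = (j, i)" by (cases p)
    show ?thesis
    proof (cases "j < q")
      case True
      have "f (crd j 0) < L" using f .
      then have "x $ crd j 0 / 5 \<le> 6 * (6 * L)"
        using far_point_block_0[OF True] by (simp add: x_def)
      moreover have "6 * (6 * L) \<le> x $ crd j (i + 1)" if "i < 5"
        using far_point_block[OF True, of "i + 1"] that by (simp add: x_def)
      moreover have "0 \<le> x $ crd j 0" using far_point_block_0[OF True] by (simp add: x_def)
      ultimately show ?thesis by (auto simp: l_def ji True)
    next
      case False
      then show ?thesis using p far_point_rest[of i] by (auto simp: l_def ji idx_def x_def)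
    qed
  qed
  ultimately have "x \<in> C" unfolding C_def by blast
  moreover have "x $ t \<in> \<int>" for t by (simp add: x_def far_point_def)
  ultimately show ?thesis by (simp add: int_points_def x_def)
qed

lemma card_idx_support:
  fixes \<mu> :: "nat \<times> nat \<Rightarrow> nat"
  shows "card {p\<in>idx. \<mu> p \<noteq> 0} = (\<Sum>j<q. card {i\<in>{..<10}. \<mu> (j, i) \<noteq> 0}) + card {i\<in>{..<r}. \<mu> (q, i) \<noteq> 0}"
proof -
  have card: "card {p\<in>A. P p} = (\<Sum>p\<in>A. if P p then 1 else 0)" if "finite A" for A :: "'b set" and P
    using that by (simp add: sum.If_cases Int_def)
  show ?thesis by (simp only: card finite_idx finite_lessThan sum_idx)
qed

text \<open>Every block needs seven generators by \<open>block_support\<close>, and each orthant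
  coordinate, positive because of the \<open>+ 1\<close> in \<open>far_point\<close>, needs its own
  unit vector.\<close>

lemma far_point_length:
  assumes f: "\<And>t. f t < L"
  shows "7 * q + r \<le> hilbert_length C (far_point L f)"
proof -
  obtain \<mu> :: "nat \<times> nat \<Rightarrow> nat" where \<mu>: "far_point L f = (\<Sum>p\<in>idx. real (\<mu> p) *\<^sub>R gen p)"
    and card: "card {p\<in>idx. \<mu> p \<noteq> 0} \<le> hilbert_length C (far_point L f)"
    using far_point_in_int_points[where f = f, OF f] by (rule hilbert_length_support)
  have "7 \<le> card {i\<in>{..<10}. \<mu> (j, i) \<noteq> 0}" if j: "j < q" for j
  proof -
    have sums: "real_of_int (\<Sum>i<10. int (\<mu> (j, i)) * block_gen i s) = far_point L f $ crd j s" if "s < 6" for s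
      unfolding \<mu> sum_gen_block[OF j that] by simp
    have bound: "f t \<le> L" "1 \<le> L" for t using f[of t] by linarith+
    show ?thesis
    proof (rule block_support[where L = "int L" and P = "int (15 * L + f (crd j 0))" and Q = "\<lambda>s. int (6 * L + f (crd j s))"])
      show "(\<Sum>i<10. int (\<mu> (j, i)) * block_gen i 0) = 6 * int (15 * L + f (crd j 0)) + 1"
        using sums[of 0] unfolding far_point_block_0[OF j] by linarith
      fix s :: nat assume "s \<in> {1..5}"
      then have s: "0 < s" "s < 6" by auto
      show "(\<Sum>i<10. int (\<mu> (j, i)) * block_gen i s) = 6 * int (6 * L + f (crd j s))"
        using sums[OF s(2)] unfolding far_point_block[OF j s] by linarith
    qed (use bound in auto)
  qed
  then have "(\<Sum>j<q. 7) \<le> (\<Sum>j<q. card {i\<in>{..<10}. \<mu> (j, i) \<noteq> 0})" by (intro sum_mono) simp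
  moreover have "\<mu> (q, k) \<noteq> 0" if "k < r" for k
  proof -
    have "real (\<mu> (q, k)) = real (f (crd q k) + 1)"
      using far_point_rest[OF that, of L f] unfolding \<mu> sum_gen_rest[OF that] .
    then show ?thesis by simp
  qed
  then have "{i\<in>{..<r}. \<mu> (q, i) \<noteq> 0} = {..<r}" by auto
  ultimately have "7 * q + r \<le> card {p\<in>idx. \<mu> p \<noteq> 0}"
    unfolding card_idx_support by simp
  then show ?thesis using card by linarith
qed

section \<open>Density estimate and the bound on the rank\<close>

text \<open>The box holds at most \<open>(2 * 97 * L + 1) ^ n \<le> (195 * L) ^ n\<close> integer
  points of the cone, where n is the dimension, and the \<open>L ^ n\<close> far points among them
  are too long to be counted in the numerator.\<close>

lemma short_points_ratio_le:
  assumes k: "k < 7 * q + r" and L: "1 \<le> L"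
  shows "real (card (box_points {x \<in> int_points C. hilbert_length C x \<le> k} (real (97 * L))))
    / real (card (box_points (int_points C) (real (97 * L)))) \<le> 1 - 1 / 195 ^ CARD('n)"
proof -
  define A where "A = box_points (int_points C) (real (97 * L))"
  define B where "B = box_points {x \<in> int_points C. hilbert_length C x \<le> k} (real (97 * L))"
  define F where "F = PiE (UNIV :: 'n set) (\<lambda>_. {..<L})"
  have A: "finite A" "card A \<le> (2 * (97 * L) + 1) ^ CARD('n)"
    unfolding A_def by (rule box_points_C)+
  have "card A \<le> (195 * L) ^ CARD('n)"
    using L by (intro order_trans[OF A(2)] power_mono) auto
  then have A_le: "real (card A) \<le> 195 ^ CARD('n) * real L ^ CARD('n)"
    unfolding power_mult_distrib[symmetric] by (metis of_nat_le_iff of_nat_mult of_nat_numeral of_nat_power)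
  have "far_point L f \<in> A - B" if "f \<in> F" for f
  proof -
    have f: "f t < L" for t using that by (auto simp: F_def PiE_def Pi_def)
    have "- real (97 * L) \<le> far_point L f $ t \<and> far_point L f $ t \<le> real (97 * L)" for t
      using far_point_bounds[where f = f and t = t, OF f] by linarith
    then have "far_point L f \<in> A"
      using far_point_in_int_points[where f = f, OF f] unfolding A_def box_points_def by (simp add: mem_box_cart)
    moreover have "far_point L f \<notin> B"
      using far_point_length[where f = f, OF f] k by (simp add: B_def box_points_def)
    ultimately show ?thesis by blast
  qed
  then have "far_point L ` F \<subseteq> A - B" by blast
  then have "card (far_point L ` F) \<le> card (A - B)" using A(1) by (intro card_mono) auto
  moreover have "card (far_point L ` F) = L ^ CARD('n)"
    unfolding card_image[OF inj_far_point] F_def by (simp add: card_PiE)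
  moreover have "B \<subseteq> A" by (auto simp: A_def B_def box_points_def)
  moreover from this have "card (A - B) = card A - card B" "card B \<le> card A"
    using A(1) by (auto intro: card_Diff_subset card_mono finite_subset)
  ultimately have "L ^ CARD('n) + card B \<le> card A" by linarith
  then have AB: "real L ^ CARD('n) + real (card B) \<le> real (card A)"
    by (metis of_nat_add of_nat_le_iff of_nat_power)
  have "0 < real L ^ CARD('n)" using L by simp
  then have pos: "0 < real (card A)" using AB by linarith
  have "real (card A) / 195 ^ CARD('n) \<le> real L ^ CARD('n)"
    using A_le by (simp add: field_simps)
  then have "real (card B) \<le> (1 - 1 / 195 ^ CARD('n)) * real (card A)"
    using AB by (simp add: left_diff_distrib)
  then show ?thesis unfolding A_def[symmetric] B_def[symmetric] using pos by (simp add: pos_divide_le_eq)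
qed

lemma not_tendsto_short_points_ratio:
  assumes k: "k < 7 * q + r"
  shows "\<not> ((\<lambda>\<delta>. real (card (box_points {x \<in> int_points C. hilbert_length C x \<le> k} \<delta>))
    / real (card (box_points (int_points C) \<delta>))) \<longlongrightarrow> 1) at_top" (is "\<not> (?ratio \<longlongrightarrow> 1) at_top")
proof
  assume "(?ratio \<longlongrightarrow> 1) at_top"
  \<comment> \<open>A limit at infinity would also be the limit along the radii
    \<open>97 * L\<close>, where the ratio stays away from 1.\<close>
  moreover have "filterlim (\<lambda>L. real (97 * L)) at_top sequentially"
    by (intro filterlim_compose[OF filterlim_real_sequentially] filterlim_subseq) (simp add: strict_mono_def)
  ultimately have "(\<lambda>L. ?ratio (real (97 * L))) \<longlonglongrightarrow> 1"
    by (rule filterlim_compose)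
  then have "1 \<le> 1 - 1 / (195::real) ^ CARD('n)"
    using short_points_ratio_le[OF k] by (intro LIMSEQ_le_const2) blast+
  moreover have "0 < 1 / (195::real) ^ CARD('n)" by simp
  ultimately show False by linarith
qed

lemma asymptotic_caratheodory_rank_ge: "7 * q + r \<le> asymptotic_caratheodory_rank C"
proof -
  define ratio where "ratio k \<delta> = real (card (box_points {x \<in> int_points C. hilbert_length C x \<le> k} \<delta>))
    / real (card (box_points (int_points C) \<delta>))" for k \<delta>
  \<comment> \<open>A bound on all Hilbert lengths, made positive by the \<open>+ 1\<close>: its
    ratio is 1 for every nonnegative radius, so the \<open>LEAST\<close> defining the rank is
    attained.\<close>
  define K where "K = card (gen ` idx) + 1"
  have "ratio K \<delta> = 1" if "0 \<le> \<delta>" for \<delta>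
  proof -
    have "{x \<in> int_points C. hilbert_length C x \<le> K} = int_points C"
      using hilbert_length_le unfolding K_def by fastforce
    moreover have "finite (box_points (int_points C) \<delta>)"
    proof (rule finite_subset)
      show "box_points (int_points C) \<delta> \<subseteq> box_points (int_points C) (real (nat \<lceil>\<delta>\<rceil>))"
      proof
        fix x assume x: "x \<in> box_points (int_points C) \<delta>"
        have "- real (nat \<lceil>\<delta>\<rceil>) \<le> x $ t \<and> x $ t \<le> real (nat \<lceil>\<delta>\<rceil>)" for t
        proof -
          have "- \<delta> \<le> x $ t" "x $ t \<le> \<delta>" using x by (simp_all add: box_points_def mem_box_cart)
          then show ?thesis using real_nat_ceiling_ge[of \<delta>] by linarith
        qed
        then show "x \<in> box_points (int_points C) (real (nat \<lceil>\<delta>\<rceil>))"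
          using x by (simp add: box_points_def mem_box_cart)
      qed
    qed (rule box_points_C)
    moreover have "0 \<in> C" unfolding C_def by (intro CollectI exI[of _ "\<lambda>_. 0"]) simp
    then have "0 \<in> box_points (int_points C) \<delta>"
      using that by (auto simp: box_points_def int_points_def mem_box_cart)
    ultimately show ?thesis by (auto simp: ratio_def card_eq_0_iff)
  qed
  then have "(ratio K \<longlongrightarrow> 1) at_top"
    by (intro tendsto_eventually eventually_mono[OF eventually_ge_at_top[of 0]])
  then have "\<exists>k. k > 0 \<and> (ratio k \<longlongrightarrow> 1) at_top" by (intro exI[of _ K]) (simp add: K_def)
  then have "(ratio (LEAST k. k > 0 \<and> (ratio k \<longlongrightarrow> 1) at_top) \<longlongrightarrow> 1) at_top"
    by (rule LeastI2_ex) simp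
  then have "(ratio (asymptotic_caratheodory_rank C) \<longlongrightarrow> 1) at_top"
    unfolding asymptotic_caratheodory_rank_def ratio_def .
  then show ?thesis
    using not_tendsto_short_points_ratio unfolding ratio_def by (meson not_le)
qed

end

theorem theorem2:
  assumes "CARD('n::finite) \<ge> 6"
  shows "\<exists>C :: (real ^ 'n) set.
           rational_cone C \<and> pointed C \<and> dim C = CARD('n) \<and>
           int (asymptotic_caratheodory_rank C) \<ge> \<lfloor>7 / 6 * real CARD('n)\<rfloor>"
proof -
  define q where "q = CARD('n) div 6"
  define r where "r = CARD('n) mod 6"
  have n: "CARD('n) = 6 * q + r" and r: "r < 6" by (simp_all add: q_def r_def)
  obtain pos :: "'n \<Rightarrow> nat" where "bij_betw pos UNIV {..<6 * q + r}"
    using ex_bij_betw_finite_nat[of "UNIV :: 'n set"] unfolding n atLeast0LessThan by auto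
  then interpret block_cone pos q r using r by unfold_locales
  \<comment> \<open>The difference between the left side and \<open>7 * q + r\<close> is
    \<open>r / 6\<close>, which is below 1.\<close>
  have "7 / 6 * real CARD('n) < real (7 * q + r) + 1" using r unfolding n by simp
  then have "\<lfloor>7 / 6 * real CARD('n)\<rfloor> \<le> int (7 * q + r)" by linarith
  also have "\<dots> \<le> int (asymptotic_caratheodory_rank C)" using asymptotic_caratheodory_rank_ge by simp
  finally show ?thesis using rational_cone_C pointed_C dim_C by blast
qed

end
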